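(* Let $A=(a_{i,j})\in\mathbb{R}^{n\times n}$ be a fixed matrix, let $\mathbb{S}(n)$ be the symmetric group on $n$ elements, let $x\in S^{n-1}$ be a fixed vector, and let $F:\mathbb{S}(n)\to\mathbb{R}$ be defined by $$F(\pi)=(\pi x)^{\mathrm T}A(\pi x)=\sum_{i,j=1}^n a_{i,j}x_{\pi(i)}x_{\pi(j)},$$ where $\pi$ is a uniformly distributed random permutation of $\{1,\ldots,n\}$. Then, for all $t>0$, $$\mathbb{P}\left(F(\pi)-\mathbb{E}F(\pi)>t\right)\le \exp\left(-\frac{t^2}{16\,\rho(B)^2}\right),$$ where $\rho(B)$ is the spectral radius of $B=(A+A^{\mathrm T})/2$.
   Context: $S^{n-1}$ is the Euclidean unit sphere in $\mathbb{R}^n$. For a permutation $\pi$ and $x\in\mathbb{R}^n$, $\pi x$ is the vector with entries $(\pi x)_i=x_{\pi(i)}$. *)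

theory Defs
  imports
    "HOL-Probability.Probability_Mass_Function"
    "HOL-Combinatorics.Permutations"
    "Jordan_Normal_Form.Spectral_Radius"
begin

hide_const (open) Finite_Cartesian_Product.vec Finite_Cartesian_Product.vec_nth
no_notation Finite_Cartesian_Product.vec_nth (infixl \<open>$\<close> 90)
no_notation Inner_Product.real_inner_class.inner (infix \<open>\<bullet>\<close> 70)

text \<open>Coordinates are indexed by \<open>{..<n}\<close>, as usual for \<^typ>\<open>real vec\<close>, rather than by \<open>{1..n}\<close>.\<close>

definition unit_sphere :: "nat \<Rightarrow> real vec set" where
  "unit_sphere n = {x \<in> carrier_vec n. sqrt (\<Sum>i<n. (x $ i)\<^sup>2) = 1}"

definition permute_vec :: "(nat \<Rightarrow> nat) \<Rightarrow> 'a vec \<Rightarrow> 'a vec" where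
  "permute_vec p x = vec (dim_vec x) (\<lambda>i. x $ p i)"

definition perm_quad_form :: "real mat \<Rightarrow> real vec \<Rightarrow> (nat \<Rightarrow> nat) \<Rightarrow> real" where
  "perm_quad_form A x p = permute_vec p x \<bullet> (A *\<^sub>v permute_vec p x)"

lemma perm_quad_form_eq_sum:
  assumes "A \<in> carrier_mat n n" and "x \<in> carrier_vec n"
  shows "perm_quad_form A x p = (\<Sum>i<n. \<Sum>j<n. A $$ (i, j) * x $ p i * x $ p j)"
  using assms
  by (auto simp: perm_quad_form_def permute_vec_def scalar_prod_def sum_distrib_left
      lessThan_atLeast0 mult_ac intro!: sum.cong)

definition uniform_perm :: "nat \<Rightarrow> (nat \<Rightarrow> nat) pmf" where
  "uniform_perm n = pmf_of_set {p. p permutes {..<n}}"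

definition sym_part :: "real mat \<Rightarrow> real mat" where
  "sym_part A = (1 / 2) \<cdot>\<^sub>m (A + A\<^sup>T)"

text \<open>The library's \<^const>\<open>spectral_radius\<close> is defined for complex matrices.\<close>

definition real_spectral_radius :: "real mat \<Rightarrow> real" where
  "real_spectral_radius B = spectral_radius (map_mat complex_of_real B)"

end

theory Submission imports Defs "HOL-Probability.Hoeffding"
begin

no_notation Inner_Product.real_inner_class.inner (infix \<open>\<bullet>\<close> 70)

text \<open>On the unit sphere the quadratic form only sees \<open>B = sym_part A\<close> and takes values in
  \<open>[-\<rho>(B), \<rho>(B)]\<close>. Hoeffding's lemma for a single random variable with values in an interval of
  length \<open>2 * \<rho>(B)\<close> already yields the stronger bound \<open>exp (- t\<^sup>2 / (2 * \<rho>(B)\<^sup>2))\<close>; independence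
  plays no role.

  For the Rayleigh bound, symmetry and Cauchy-Schwarz give \<open>(y \<bullet> D\<^sup>m y)\<^sup>2 \<le> y \<bullet> D\<^sup>2\<^sup>m y\<close> for a unit
  vector \<open>y\<close>. If the spectral radius of \<open>D\<close> is below \<open>1\<close>, the powers of \<open>D\<close> are bounded, so
  iterating over \<open>m = 1, 2, 4, \<dots>\<close> forces \<open>\<bar>y \<bullet> D y\<bar> \<le> 1\<close>; the general case follows by scaling.\<close>

section \<open>Quadratic forms of powers of a symmetric matrix\<close>

lemma scalar_prod_Cauchy_Schwarz:
  fixes u v :: "real vec"
  assumes "u \<in> carrier_vec n" "v \<in> carrier_vec n"
  shows "(u \<bullet> v)\<^sup>2 \<le> (u \<bullet> u) * (v \<bullet> v)"
  using Cauchy_Schwarz_ineq_sum[of "\<lambda>i. u $ i" "\<lambda>i. v $ i" "{0..<n}"] assms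
  by (simp add: scalar_prod_def power2_eq_square)

lemma pow_mat_add:
  assumes "(A :: 'a :: semiring_1 mat) \<in> carrier_mat n n"
  shows "A ^\<^sub>m (k + l) = A ^\<^sub>m k * A ^\<^sub>m l"
proof (induction l)
  case (Suc l)
  then show ?case using assms
    by (simp add: assoc_mult_mat[of _ n n _ n _ n])
qed (use assms in simp)

lemma transpose_pow_mat:
  assumes "(A :: 'a :: comm_semiring_1 mat) \<in> carrier_mat n n"
  shows "(A ^\<^sub>m k)\<^sup>T = A\<^sup>T ^\<^sub>m k"
proof (induction k)
  case (Suc k)
  have "(A ^\<^sub>m Suc k)\<^sup>T = A\<^sup>T ^\<^sub>m 1 * A\<^sup>T ^\<^sub>m k"
    using assms Suc by (simp add: transpose_mult[of _ n n _ n])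
  also have "\<dots> = A\<^sup>T ^\<^sub>m Suc k"
    using assms pow_mat_add[of "A\<^sup>T" n 1 k] by simp
  finally show ?case .
qed (use assms in simp)

text \<open>Cauchy-Schwarz is applied to \<open>y\<close> and
  \<open>D ^\<^sub>m m *\<^sub>v y\<close>. Since powers of a symmetric matrix are symmetric, one
  factor moves across the scalar product and doubles the exponent.\<close>

lemma quad_form_pow_sq_le:
  fixes D :: "real mat"
  assumes D: "D \<in> carrier_mat n n" "D\<^sup>T = D" and y: "y \<in> carrier_vec n" "y \<bullet> y = 1"
  shows "(y \<bullet> (D ^\<^sub>m m *\<^sub>v y))\<^sup>2 \<le> y \<bullet> (D ^\<^sub>m (2 * m) *\<^sub>v y)"
proof -
  let ?E = "D ^\<^sub>m m"
  have E: "?E \<in> carrier_mat n n" and sym: "?E\<^sup>T = ?E"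
    using D by (simp_all add: transpose_pow_mat)
  have "(y \<bullet> (?E *\<^sub>v y))\<^sup>2 \<le> (?E *\<^sub>v y) \<bullet> (?E *\<^sub>v y)"
    using scalar_prod_Cauchy_Schwarz[OF y(1) mult_mat_vec_carrier[OF E y(1)]] y(2) by simp
  also have "\<dots> = y \<bullet> (?E *\<^sub>v (?E *\<^sub>v y))"
    using transpose_vec_mult_scalar[OF E mult_mat_vec_carrier[OF E y(1)] y(1)] sym by simp
  also have "?E *\<^sub>v (?E *\<^sub>v y) = D ^\<^sub>m (2 * m) *\<^sub>v y"
    using assoc_mult_mat_vec[OF E E y(1)] pow_mat_add[OF D(1), of m m] by (simp add: mult_2)
  finally show ?thesis .
qed

lemma abs_quad_form_pow_le:
  fixes D :: "real mat"
  assumes D: "D \<in> carrier_mat n n" "D\<^sup>T = D" and y: "y \<in> carrier_vec n" "y \<bullet> y = 1"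
  shows "\<bar>y \<bullet> (D *\<^sub>v y)\<bar> ^ (2 ^ k) \<le> \<bar>y \<bullet> (D ^\<^sub>m (2 ^ k) *\<^sub>v y)\<bar>"
proof (induction k)
  case 0
  then show ?case using D by simp
next
  case (Suc k)
  have "\<bar>y \<bullet> (D *\<^sub>v y)\<bar> ^ (2 ^ Suc k) = (\<bar>y \<bullet> (D *\<^sub>v y)\<bar> ^ (2 ^ k))\<^sup>2"
    by (simp add: mult.commute flip: power_mult)
  also have "\<dots> \<le> \<bar>y \<bullet> (D ^\<^sub>m (2 ^ k) *\<^sub>v y)\<bar>\<^sup>2"
    using Suc by (intro power_mono) auto
  also have "\<dots> \<le> \<bar>y \<bullet> (D ^\<^sub>m (2 ^ Suc k) *\<^sub>v y)\<bar>"
    using quad_form_pow_sq_le[OF assms, of "2 ^ k"] by simp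
  finally show ?case .
qed

text \<open>A crude estimate suffices: the factor next to \<open>c\<close> depends on
  \<open>y\<close> alone, so a common entry bound for all powers of a matrix bounds all their
  quadratic forms at once.\<close>

lemma abs_quad_form_le_sum:
  fixes A :: "real mat"
  assumes A: "A \<in> carrier_mat n n" and y: "y \<in> carrier_vec n"
    and c: "\<And>i j. i < n \<Longrightarrow> j < n \<Longrightarrow> \<bar>A $$ (i, j)\<bar> \<le> c"
  shows "\<bar>y \<bullet> (A *\<^sub>v y)\<bar> \<le> c * (\<Sum>i<n. \<bar>y $ i\<bar>)\<^sup>2"
proof -
  have "y \<bullet> (A *\<^sub>v y) = (\<Sum>i<n. \<Sum>j<n. y $ i * (A $$ (i, j) * y $ j))"
    using A y by (auto simp: scalar_prod_def sum_distrib_left lessThan_atLeast0 intro!: sum.cong)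
  also have "\<bar>\<dots>\<bar> \<le> (\<Sum>i<n. \<Sum>j<n. \<bar>y $ i\<bar> * (c * \<bar>y $ j\<bar>))"
    by (intro order.trans[OF sum_abs] sum_mono)
       (use c in \<open>auto simp: abs_mult intro!: mult_left_mono mult_right_mono\<close>)
  also have "\<dots> = c * (\<Sum>i<n. \<bar>y $ i\<bar>)\<^sup>2"
    by (simp add: power2_eq_square sum_product sum_distrib_left mult_ac)
  finally show ?thesis .
qed

text \<open>This comes from the Jordan normal form of the complexified matrix. The inequality is
  strict because a nontrivial Jordan block with an eigenvalue of modulus 1 has unbounded
  powers.\<close>

lemma real_pow_mat_bounded:
  assumes D: "D \<in> carrier_mat n n" and sr: "real_spectral_radius D < 1"
  obtains c where "\<And>k i j. i < n \<Longrightarrow> j < n \<Longrightarrow> \<bar>(D ^\<^sub>m k) $$ (i, j)\<bar> \<le> c"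
proof -
  let ?C = "map_mat complex_of_real D"
  have C: "?C \<in> carrier_mat n n" using D by simp
  obtain c where c: "norm_bound (?C ^\<^sub>m k) c" for k
    using spectral_radius_jnf_norm_bound_less_1_upper_triangular[OF C] sr
    unfolding real_spectral_radius_def by blast
  have "\<bar>(D ^\<^sub>m k) $$ (i, j)\<bar> \<le> c" if "i < n" "j < n" for k i j
  proof -
    have "?C ^\<^sub>m k = map_mat complex_of_real (D ^\<^sub>m k)"
      by (rule of_real_hom.mat_hom_pow[OF D, symmetric])
    then show ?thesis
      using c[of k] that D unfolding norm_bound_def by auto
  qed
  then show thesis by (rule that)
qed

lemma abs_quad_form_le_1:
  fixes D :: "real mat"
  assumes D: "D \<in> carrier_mat n n" "D\<^sup>T = D" and y: "y \<in> carrier_vec n" "y \<bullet> y = 1"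
    and sr: "real_spectral_radius D < 1"
  shows "\<bar>y \<bullet> (D *\<^sub>v y)\<bar> \<le> 1"
proof (rule ccontr)
  let ?q = "\<bar>y \<bullet> (D *\<^sub>v y)\<bar>"
  assume "\<not> ?q \<le> 1"
  then have q: "?q > 1" by simp
  obtain c where c: "\<And>k i j. i < n \<Longrightarrow> j < n \<Longrightarrow> \<bar>(D ^\<^sub>m k) $$ (i, j)\<bar> \<le> c"
    using real_pow_mat_bounded[OF D(1) sr] by blast
  define M where "M = c * (\<Sum>i<n. \<bar>y $ i\<bar>)\<^sup>2"
  obtain k where k: "M < ?q ^ k"
    using real_arch_pow[OF q] by blast
  \<comment> \<open>Repeated squaring only reaches exponents that are powers of two;
    \<open>k \<le> 2 ^ k\<close> and \<open>?q > 1\<close> allow the passage to one of them.\<close>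
  also have "?q ^ k \<le> ?q ^ (2 ^ k)"
    using q by (intro power_increasing) (auto simp: less_imp_le)
  also have "\<dots> \<le> M"
    using abs_quad_form_pow_le[OF D y, of k]
      abs_quad_form_le_sum[OF pow_carrier_mat[OF D(1)] y(1) c, of "2 ^ k"]
    unfolding M_def by linarith
  finally show False by simp
qed

section \<open>Scaling and the Rayleigh bound\<close>

lemma real_spectral_radius_nonneg:
  assumes "B \<in> carrier_mat n n" "n > 0"
  shows "real_spectral_radius B \<ge> 0"
  using spectral_radius_mem_max(1)[of "map_mat complex_of_real B" n] assms
  unfolding real_spectral_radius_def by auto

lemma eigenvalue_smult_mat:
  fixes A :: "'a :: field mat"
  assumes A: "A \<in> carrier_mat n n" and "c \<noteq> 0" and "eigenvalue (c \<cdot>\<^sub>m A) e"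
  shows "eigenvalue A (e / c)"
proof -
  obtain v where v: "v \<in> carrier_vec n" "v \<noteq> 0\<^sub>v n" "(c \<cdot>\<^sub>m A) *\<^sub>v v = e \<cdot>\<^sub>v v"
    using assms unfolding eigenvalue_def eigenvector_def by auto
  have "A *\<^sub>v v = (1 / c) \<cdot>\<^sub>v ((c \<cdot>\<^sub>m A) *\<^sub>v v)"
    using A v(1) \<open>c \<noteq> 0\<close> by (intro eq_vecI) (auto simp: scalar_prod_smult_left)
  also have "\<dots> = (e / c) \<cdot>\<^sub>v v"
    unfolding v(3) using \<open>c \<noteq> 0\<close> by (intro eq_vecI) auto
  finally show ?thesis
    using A v unfolding eigenvalue_def eigenvector_def by auto
qed

text \<open>For \<open>n > 0\<close> the spectrum is nonempty, so the left side is the modulus of an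
  actual eigenvalue \<open>e\<close>; then \<open>e / c\<close> is an eigenvalue of
  \<open>B\<close>.\<close>

lemma real_spectral_radius_smult_le:
  assumes B: "B \<in> carrier_mat n n" and n: "n > 0" and c: "c \<noteq> 0"
  shows "real_spectral_radius (c \<cdot>\<^sub>m B) \<le> \<bar>c\<bar> * real_spectral_radius B"
proof -
  let ?C = "map_mat complex_of_real B"
  have C: "?C \<in> carrier_mat n n" using B by simp
  have eq: "map_mat complex_of_real (c \<cdot>\<^sub>m B) = complex_of_real c \<cdot>\<^sub>m ?C"
    by (intro eq_matI) auto
  obtain e where e: "eigenvalue (complex_of_real c \<cdot>\<^sub>m ?C) e"
    "real_spectral_radius (c \<cdot>\<^sub>m B) = norm e"
    using spectral_radius_mem_max(1)[of "complex_of_real c \<cdot>\<^sub>m ?C" n] C n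
    unfolding real_spectral_radius_def eq spectrum_def by auto
  have "eigenvalue ?C (e / complex_of_real c)"
    using eigenvalue_smult_mat[OF C _ e(1)] c by simp
  then have "norm (e / complex_of_real c) \<le> real_spectral_radius B"
    using spectral_radius_mem_max(2)[OF C n]
    unfolding real_spectral_radius_def spectrum_def by blast
  then show ?thesis
    using c e(2) by (simp add: norm_divide field_simps)
qed

lemma abs_quad_form_le_spectral_radius:
  fixes B :: "real mat"
  assumes B: "B \<in> carrier_mat n n" "B\<^sup>T = B" and y: "y \<in> carrier_vec n" "y \<bullet> y = 1"
    and n: "n > 0"
  shows "\<bar>y \<bullet> (B *\<^sub>v y)\<bar> \<le> real_spectral_radius B"
\<comment> \<open>Dividing by some \<open>r\<close> strictly above the spectral radius makes the
  radius of \<open>?D\<close> less than 1, and also covers a \<open>B\<close> of spectral radius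
  0.\<close>
proof (rule dense_ge)
  fix r assume r: "real_spectral_radius B < r"
  have "r > 0" using r real_spectral_radius_nonneg[OF B(1) n] by linarith
  let ?D = "(1 / r) \<cdot>\<^sub>m B"
  have "real_spectral_radius ?D \<le> (1 / r) * real_spectral_radius B"
    using real_spectral_radius_smult_le[OF B(1) n, of "1 / r"] \<open>r > 0\<close> by simp
  also have "\<dots> < 1" using r \<open>r > 0\<close> by simp
  finally have sr: "real_spectral_radius ?D < 1" .
  have "B\<^sup>T $$ (i, j) = B $$ (j, i)" if "i < n" "j < n" for i j
    using B(1) that by auto
  then have sym: "?D\<^sup>T = ?D"
    unfolding B(2) using B(1) by (intro eq_matI) auto
  have "y \<bullet> (?D *\<^sub>v y) = (1 / r) * (y \<bullet> (B *\<^sub>v y))"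
  proof -
    have "?D *\<^sub>v y = (1 / r) \<cdot>\<^sub>v (B *\<^sub>v y)"
      using B(1) y(1) by (intro eq_vecI) auto
    then show ?thesis using B(1) y(1) by simp
  qed
  then show "\<bar>y \<bullet> (B *\<^sub>v y)\<bar> \<le> r"
    using abs_quad_form_le_1[of ?D n y] B(1) sym y sr \<open>r > 0\<close> by (simp add: abs_mult)
qed

section \<open>The symmetric part and permuted unit vectors\<close>

lemma sym_part_carrier [simp]: "A \<in> carrier_mat n n \<Longrightarrow> sym_part A \<in> carrier_mat n n"
  by (simp add: sym_part_def)

lemma transpose_sym_part: "A \<in> carrier_mat n n \<Longrightarrow> (sym_part A)\<^sup>T = sym_part A"
  by (intro eq_matI) (auto simp: sym_part_def)

text \<open>\<open>A\<close> and its transpose have the same quadratic form, hence so does their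
  average.\<close>

lemma quad_form_sym_part:
  assumes A: "A \<in> carrier_mat n n" and y: "y \<in> carrier_vec n"
  shows "y \<bullet> (sym_part A *\<^sub>v y) = y \<bullet> (A *\<^sub>v y)"
proof -
  have "sym_part A *\<^sub>v y = (1 / 2) \<cdot>\<^sub>v (A *\<^sub>v y + A\<^sup>T *\<^sub>v y)"
    using A y by (intro eq_vecI) (auto simp: sym_part_def add_scalar_prod_distrib[of _ n])
  moreover have "y \<bullet> (A\<^sup>T *\<^sub>v y) = y \<bullet> (A *\<^sub>v y)"
    using transpose_vec_mult_scalar[OF A y y] A y comm_scalar_prod[of y n "A\<^sup>T *\<^sub>v y"] by simp
  ultimately show ?thesis
    using A y by (simp add: scalar_prod_add_distrib[of _ n])
qed

lemma permute_vec_self_scalar_prod: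
  fixes x :: "'a :: semiring_0 vec"
  assumes "x \<in> carrier_vec n" "p permutes {..<n}"
  shows "permute_vec p x \<bullet> permute_vec p x = x \<bullet> x"
  using assms sum.permute[OF assms(2), of "\<lambda>i. x $ i * x $ i"]
  by (simp add: permute_vec_def scalar_prod_def lessThan_atLeast0 o_def)

text \<open>The dimension is positive because an empty sum of squares is 0; this supplies the
  \<open>n > 0\<close> of the spectral radius lemmas.\<close>

lemma unit_sphereD:
  assumes "x \<in> unit_sphere n"
  shows "x \<in> carrier_vec n" "x \<bullet> x = 1" "n > 0"
  using assms
  by (auto simp: unit_sphere_def scalar_prod_def lessThan_atLeast0 power2_eq_square
      intro: Nat.gr0I)

lemma abs_perm_quad_form_le:
  assumes A: "A \<in> carrier_mat n n" and x: "x \<in> unit_sphere n" and p: "p permutes {..<n}"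
  shows "\<bar>perm_quad_form A x p\<bar> \<le> real_spectral_radius (sym_part A)"
proof -
  let ?y = "permute_vec p x"
  have y: "?y \<in> carrier_vec n" "?y \<bullet> ?y = 1"
    using unit_sphereD[OF x] permute_vec_self_scalar_prod[OF _ p, of x]
    by (auto simp: permute_vec_def)
  show ?thesis
    using abs_quad_form_le_spectral_radius[OF sym_part_carrier[OF A] transpose_sym_part[OF A] y]
      unit_sphereD(3)[OF x] quad_form_sym_part[OF A y(1)]
    by (simp add: perm_quad_form_def)
qed

section \<open>The tail bound\<close>

lemma (in interval_bounded_random_variable) Hoeffding_single:
  assumes t: "t > 0" and ab: "a < b"
  shows "prob {x \<in> space M. f x - expectation f \<ge> t} \<le> exp (- 2 * t\<^sup>2 / (b - a)\<^sup>2)"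
proof -
  \<comment> \<open>This \<open>l\<close> minimises
    \<open>- l * t + l\<^sup>2 * (b - a)\<^sup>2 / 8\<close>, the exponent obtained from the
    Chernoff bound and Hoeffding's lemma.\<close>
  define l where "l = 4 * t / (b - a)\<^sup>2"
  have l: "l > 0" using t ab by (simp add: l_def)
  have "ennreal (prob {x \<in> space M. f x - expectation f \<ge> t})
      \<le> ennreal (exp (- l * t)) * (\<integral>\<^sup>+x\<in>space M. exp (l * (f x - expectation f)) \<partial>M)"
    unfolding emeasure_eq_measure[symmetric]
    by (intro Chernoff_ineq_nn_integral_ge l) auto
  also have "(\<integral>\<^sup>+x\<in>space M. exp (l * (f x - expectation f)) \<partial>M)
      = (\<integral>\<^sup>+x. exp (l * (f x - expectation f)) \<partial>M)"
    by (intro nn_integral_cong) simp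
  also have "ennreal (exp (- l * t)) * \<dots>
      \<le> ennreal (exp (- l * t)) * ennreal (exp (l\<^sup>2 * (b - a)\<^sup>2 / 8))"
    by (intro mult_left_mono Hoeffdings_lemma_nn_integral l) auto
  also have "\<dots> = ennreal (exp (- l * t + l\<^sup>2 * (b - a)\<^sup>2 / 8))"
    by (simp only: exp_add ennreal_mult exp_ge_zero)
  also have "- l * t + l\<^sup>2 * (b - a)\<^sup>2 / 8 = - 2 * t\<^sup>2 / (b - a)\<^sup>2"
  proof -
    define d where "d = b - a"
    have "d > 0" using ab by (simp add: d_def)
    then show ?thesis
      unfolding l_def d_def[symmetric] by (simp add: field_simps power2_eq_square)
  qed
  finally show ?thesis by simp
qed

theorem theorem2p4:
  fixes n :: nat and A :: "real mat" and x :: "real vec" and t :: real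
  assumes "A \<in> carrier_mat n n"
    and "x \<in> unit_sphere n"
    and "t > 0"
  shows "measure_pmf.prob (uniform_perm n)
           {p. perm_quad_form A x p
                 - measure_pmf.expectation (uniform_perm n) (perm_quad_form A x) > t}
         \<le> (if real_spectral_radius (sym_part A) = 0 then 0
            else exp (- (t\<^sup>2 / (16 * (real_spectral_radius (sym_part A))\<^sup>2))))"
proof -
  define \<rho> where "\<rho> = real_spectral_radius (sym_part A)"
  let ?M = "uniform_perm n" and ?F = "perm_quad_form A x"
  let ?E = "measure_pmf.expectation ?M ?F"
  have supp: "set_pmf ?M = {p. p permutes {..<n}}"
    unfolding uniform_perm_def
    by (intro set_pmf_of_set finite_permutations) (auto intro: permutes_id)
  have AE: "AE p in measure_pmf ?M. ?F p \<in> {-\<rho>..\<rho>}"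
    using abs_perm_quad_form_le[OF assms(1,2)] supp
    by (auto simp: AE_measure_pmf_iff \<rho>_def abs_le_iff) (smt (verit))+
  show ?thesis
  proof (cases "\<rho> = 0")
    \<comment> \<open>Here HOL's \<open>t\<^sup>2 / 0 = 0\<close> would turn the exponential into 1,
      whence the separate value 0 in the claim. It holds since the form vanishes on all permutations
      and \<open>t > 0\<close>.\<close>
    case True
    have zero: "AE p in measure_pmf ?M. ?F p = 0"
      using AE True by simp
    have "?E = 0"
      using integral_cong_AE[OF _ _ zero] by simp
    then have "measure_pmf.prob ?M {p. ?F p - ?E > t} = 0"
      using zero assms(3) by (auto simp: measure_pmf_zero_iff AE_measure_pmf_iff)
    then show ?thesis by simp
  next
    case False
    then have \<rho>: "\<rho> > 0"
      using real_spectral_radius_nonneg[of "sym_part A" n] assms(1) unit_sphereD(3)[OF assms(2)]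
      by (simp add: \<rho>_def)
    interpret interval_bounded_random_variable "measure_pmf ?M" ?F "-\<rho>" \<rho>
      by unfold_locales (use AE in auto)
    have "measure_pmf.prob ?M {p. ?F p - ?E > t} \<le> measure_pmf.prob ?M {p. ?F p - ?E \<ge> t}"
      by (intro measure_pmf.finite_measure_mono) auto
    also have "\<dots> \<le> exp (- 2 * t\<^sup>2 / (\<rho> - - \<rho>)\<^sup>2)"
      using Hoeffding_single[OF assms(3)] \<rho> by simp
    \<comment> \<open>The interval has length \<open>2 * \<rho>\<close>, so the exponent on the left
      is \<open>- t\<^sup>2 / (2 * \<rho>\<^sup>2)\<close>; replacing 2 by 16 weakens the
      bound.\<close>
    also have "\<dots> \<le> exp (- (t\<^sup>2 / (16 * \<rho>\<^sup>2)))"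
      using \<rho> by (simp add: field_simps power2_eq_square)
    finally show ?thesis using False by (simp add: \<rho>_def)
  qed
qed

end
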